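(* Let $v\in\mathbb R^3$ be a unit vector, $\theta\notin2\pi\mathbb Z$, $R$ the rotation matrix of angle $\theta$ about the axis in direction $v$ at the origin, and $t\in\mathbb R^3$. Put $d=t\cdot v$ and $$c=\frac{R_{\frac{\pi-\theta}2}\bigl(t-(t\cdot v)v\bigr)}{2\sin\frac\theta2},$$ where $R_\alpha$ is the rotation of angle $\alpha$ about $v$ at the origin. Then the rigid-body motion $x\mapsto Rx+t$ is induced by the adjoint action of the following spinor in the Clifford algebra of $\mathbb R^{3,3}$: $$\exp\Bigl(\tfrac12\bigl\{(E_>E'-E_<E')(\theta v)-E'E'(\theta\, c\times v+d v)\bigr\}\Bigr).$$ Moreover, the Lie algebra $se(3)$ in bivector form is spanned by the bivectors $E'E'(x)$ and $(E_>E'-E_<E')(y)$ for $x,y\in\mathbb R^3$.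
   Context: Let $e_0,e_1,e_2,e_3$ be the standard orthonormal basis of $\mathbb R^4$ and identify $\mathbb R^3=\mathrm{span}(e_1,e_2,e_3)$. $\mathbb R^{3,3}=\Lambda^2(\mathbb R^4)$ has basis $E_i=e_0\wedge e_i$ ($i=1,2,3$), $E_1'=e_2\wedge e_3$, $E_2'=e_3\wedge e_1$, $E_3'=e_1\wedge e_2$ and symmetric bilinear form $E_i\cdot E_j'=\delta_{ij}$, $E_i\cdot E_j=E_i'\cdot E_j'=0$. In its Clifford algebra ($v^2=v\cdot v$), write $E_{ij'}=E_i\wedge E_j'$, $E_{i'j'}=E_i'\wedge E_j'$, etc. For $x=(x_1,x_2,x_3)^T$: $E'E'(x)=x_1E_{2'3'}+x_2E_{3'1'}+x_3E_{1'2'}$; $E_<E'(x)=x_1E_{23'}+x_2E_{31'}+x_3E_{12'}$; $E_>E'(x)=x_1E_{32'}+x_2E_{13'}+x_3E_{21'}$. The adjoint action of an even invertible spinor $U$ is $X\mapsto UXU^{-1}$ on $\mathbb R^{3,3}$. It induces the map $p\mapsto Rp+t$ of $\mathbb R^3$ (matrix $A=\begin{pmatrix}1&0\\t&R\end{pmatrix}$ on $\mathbb R^4$) if for every nonzero $X\in\mathbb R^4$ it maps the null 3-space $\{X\wedge Y:Y\in\mathbb R^4\}$ to $\{AX\wedge Y:Y\in\mathbb R^4\}$. $se(3)$ is the Lie algebra of matrices $\begin{pmatrix}0&0\\t&[v]_\times\end{pmatrix}\in sl(4)$, where $[v]_\times p=v\times p$. The bivector form of $M\in sl(4)$ is the unique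 bivector $B\in\Lambda^2(\mathbb R^{3,3})$ such that $B\mathbf X-\mathbf XB=(M\otimes I+I\otimes M)\mathbf X$ for all $\mathbf X\in\mathbb R^{3,3}=\Lambda^2(\mathbb R^4)$ (where $(M\otimes I+I\otimes M)(a\wedge b)=Ma\wedge b+a\wedge Mb$). *)

theory Defs
  imports "HOL-Analysis.Analysis"
begin

text \<open>
  The Clifford algebra is built on the basis of blades over an orthonormal basis with three
  generators of square 1 (indices 0, 1, 2) and three of square -1 (indices 3, 4, 5).
  The blade of a set of indices is the product of its generators in increasing order. In the
  product of two blades, the first factor of \<open>blade_sign\<close> counts the transpositions needed
  to sort the generators, the second one collects the squares of the repeated generators.
\<close>

definition metric :: "6 \<Rightarrow> real" where
  "metric k = (if k < 3 then 1 else - 1)"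

definition blade_sign :: "6 set \<Rightarrow> 6 set \<Rightarrow> real" where
  "blade_sign S T = (\<Prod>s\<in>S. \<Prod>t\<in>T. if t < s then - 1 else 1) * (\<Prod>k\<in>S \<inter> T. metric k)"

typedef cl33 = "UNIV :: (6 set \<Rightarrow> real) set"
  morphisms coeff Cl33 ..

setup_lifting type_definition_cl33

lemma cl33_eqI: "(\<And>S. coeff a S = coeff b S) \<Longrightarrow> a = b"
  by (metis coeff_inject ext)

lemma blade_sign_eq_prod_UNIV:
  "blade_sign S T =
    (\<Prod>s\<in>UNIV. \<Prod>t\<in>UNIV. if s \<in> S \<and> t \<in> T \<and> t < s then - 1 else 1) *
    (\<Prod>k\<in>UNIV. if k \<in> S \<and> k \<in> T then metric k else 1)"
proof -
  have 1: "(\<Prod>t\<in>T. if t < s then - 1 else (1::real)) = (\<Prod>t\<in>UNIV. if t \<in> T \<and> t < s then - 1 else 1)"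
    for s
    by (rule prod.mono_neutral_cong_left) auto
  have 2: "(\<Prod>s\<in>S. \<Prod>t\<in>T. if t < s then - 1 else (1::real)) =
     (\<Prod>s\<in>UNIV. \<Prod>t\<in>UNIV. if s \<in> S \<and> t \<in> T \<and> t < s then - 1 else 1)"
    unfolding 1 by (rule prod.mono_neutral_cong_left) auto
  have 3: "(\<Prod>k\<in>S \<inter> T. metric k) = (\<Prod>k\<in>UNIV. if k \<in> S \<and> k \<in> T then metric k else 1)"
    by (rule prod.mono_neutral_cong_left) auto
  show ?thesis
    unfolding blade_sign_def 2 3 ..
qed

lemma metric_square [simp]: "metric k * metric k = 1"
  by (simp add: metric_def)

lemma abs_blade_sign [simp]: "\<bar>blade_sign S T\<bar> = 1"
  by (simp add: blade_sign_def abs_mult abs_prod metric_def if_distrib[of abs] cong: if_cong)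

lemma blade_sign_empty [simp]: "blade_sign {} S = 1" "blade_sign S {} = 1"
  by (simp_all add: blade_sign_def)

lemma mult_rearrange:
  fixes a b c d e f g h :: real
  shows "a * c = e * g \<Longrightarrow> b * d = f * h \<Longrightarrow> (a * b) * (c * d) = (e * f) * (g * h)"
    and "a * b = c * d \<Longrightarrow> a * b * f * g * h = c * f * (d * g * h)"
proof -
  assume "a * c = e * g" "b * d = f * h"
  then have "(a * c) * (b * d) = (e * g) * (f * h)" by (simp only:)
  then show "(a * b) * (c * d) = (e * f) * (g * h)" by (simp only: mult_ac)
next
  assume "a * b = c * d"
  then have "a * b * f * g * h = (c * d) * f * g * h" by (simp only:)
  then show "a * b * f * g * h = c * f * (d * g * h)" by (simp only: mult_ac)
qed

lemma blade_sign_assoc: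
  "blade_sign (sym_diff T Q) U * blade_sign T Q = blade_sign T (sym_diff Q U) * blade_sign Q U"
proof -
  have 1: "(\<Prod>s\<in>UNIV. \<Prod>t\<in>UNIV. if s \<in> sym_diff T Q \<and> t \<in> U \<and> t < s then - 1 else (1::real)) *
      (\<Prod>s\<in>UNIV. \<Prod>t\<in>UNIV. if s \<in> T \<and> t \<in> Q \<and> t < s then - 1 else 1) =
      (\<Prod>s\<in>UNIV. \<Prod>t\<in>UNIV. if s \<in> T \<and> t \<in> sym_diff Q U \<and> t < s then - 1 else 1) *
      (\<Prod>s\<in>UNIV. \<Prod>t\<in>UNIV. if s \<in> Q \<and> t \<in> U \<and> t < s then - 1 else 1)"
    unfolding prod.distrib[symmetric] by (intro prod.cong refl) auto
  have 2: "(\<Prod>k\<in>UNIV. if k \<in> sym_diff T Q \<and> k \<in> U then metric k else 1) *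
      (\<Prod>k\<in>UNIV. if k \<in> T \<and> k \<in> Q then metric k else 1) =
      (\<Prod>k\<in>UNIV. if k \<in> T \<and> k \<in> sym_diff Q U then metric k else 1) *
      (\<Prod>k\<in>UNIV. if k \<in> Q \<and> k \<in> U then metric k else 1)"
    unfolding prod.distrib[symmetric]
  proof (intro prod.cong refl)
    fix k
    show "(if k \<in> sym_diff T Q \<and> k \<in> U then metric k else 1) * (if k \<in> T \<and> k \<in> Q then metric k else 1) =
      (if k \<in> T \<and> k \<in> sym_diff Q U then metric k else 1) * (if k \<in> Q \<and> k \<in> U then metric k else 1)"
      by (cases "k \<in> T"; cases "k \<in> Q"; cases "k \<in> U") simp_all
  qed
  show ?thesis
    unfolding blade_sign_eq_prod_UNIV using 1 2 by (rule mult_rearrange)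
qed

lemma bij_sym_diff: "bij (\<lambda>S. sym_diff T S)"
  by (rule o_bij[of "\<lambda>S. sym_diff T S"]) (auto simp: fun_eq_iff)

lemma bij_sym_diff': "bij (\<lambda>S. sym_diff S T)"
  by (rule o_bij[of "\<lambda>S. sym_diff S T"]) (auto simp: fun_eq_iff)

lemma sum_sym_diff: "(\<Sum>S\<in>UNIV. f (sym_diff T S)) = (\<Sum>S\<in>UNIV. f (S :: 6 set) :: real)"
  by (rule sum.reindex_bij_betw[OF bij_sym_diff])

lemma sym_diff_cancel [simp]: "sym_diff T (sym_diff T S) = S"
  by auto

instantiation cl33 :: real_algebra_1
begin

lift_definition zero_cl33 :: cl33 is "\<lambda>_. 0" .
lift_definition one_cl33 :: cl33 is "\<lambda>S. if S = {} then 1 else 0" .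
lift_definition plus_cl33 :: "cl33 \<Rightarrow> cl33 \<Rightarrow> cl33" is "\<lambda>a b S. a S + b S" .
lift_definition minus_cl33 :: "cl33 \<Rightarrow> cl33 \<Rightarrow> cl33" is "\<lambda>a b S. a S - b S" .
lift_definition uminus_cl33 :: "cl33 \<Rightarrow> cl33" is "\<lambda>a S. - a S" .
lift_definition scaleR_cl33 :: "real \<Rightarrow> cl33 \<Rightarrow> cl33" is "\<lambda>r a S. r * a S" .
lift_definition times_cl33 :: "cl33 \<Rightarrow> cl33 \<Rightarrow> cl33" is
  "\<lambda>a b U. \<Sum>S\<in>UNIV. blade_sign S (sym_diff S U) * a S * b (sym_diff S U)" .

instance
proof
  fix a b c :: cl33
  show "(a * b) * c = a * (b * c)"
  proof (rule cl33_eqI)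
    fix W
    have "coeff ((a * b) * c) W =
      (\<Sum>S\<in>UNIV. \<Sum>T\<in>UNIV. blade_sign S (sym_diff S W) * blade_sign T (sym_diff T S) *
        coeff a T * coeff b (sym_diff T S) * coeff c (sym_diff S W))"
      by (simp add: times_cl33.rep_eq sum_distrib_left sum_distrib_right mult_ac)
    also have "\<dots> = (\<Sum>T\<in>UNIV. \<Sum>S\<in>UNIV. blade_sign S (sym_diff S W) * blade_sign T (sym_diff T S) *
        coeff a T * coeff b (sym_diff T S) * coeff c (sym_diff S W))"
      by (rule sum.swap)
    also have "\<dots> = (\<Sum>T\<in>UNIV. \<Sum>Q\<in>UNIV. blade_sign T (sym_diff T W) * coeff a T *
        (blade_sign Q (sym_diff Q (sym_diff T W)) * coeff b Q * coeff c (sym_diff Q (sym_diff T W))))"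
    proof (rule sum.cong[OF refl])
      fix T
      have *: "sym_diff (sym_diff T Q) W = sym_diff Q (sym_diff T W)"
        "sym_diff Q (sym_diff Q (sym_diff T W)) = sym_diff T W" for Q
        by auto
      have "(\<Sum>S\<in>UNIV. blade_sign S (sym_diff S W) * blade_sign T (sym_diff T S) *
          coeff a T * coeff b (sym_diff T S) * coeff c (sym_diff S W)) =
        (\<Sum>Q\<in>UNIV. blade_sign (sym_diff T Q) (sym_diff (sym_diff T Q) W) *
          blade_sign T (sym_diff T (sym_diff T Q)) * coeff a T *
          coeff b (sym_diff T (sym_diff T Q)) * coeff c (sym_diff (sym_diff T Q) W))"
        by (rule sum_sym_diff[symmetric])
      also have "\<dots> = (\<Sum>Q\<in>UNIV. blade_sign T (sym_diff T W) * coeff a T *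
        (blade_sign Q (sym_diff Q (sym_diff T W)) * coeff b Q * coeff c (sym_diff Q (sym_diff T W))))"
      proof (rule sum.cong[OF refl])
        fix Q
        show "blade_sign (sym_diff T Q) (sym_diff (sym_diff T Q) W) *
          blade_sign T (sym_diff T (sym_diff T Q)) * coeff a T *
          coeff b (sym_diff T (sym_diff T Q)) * coeff c (sym_diff (sym_diff T Q) W) =
          blade_sign T (sym_diff T W) * coeff a T *
        (blade_sign Q (sym_diff Q (sym_diff T W)) * coeff b Q * coeff c (sym_diff Q (sym_diff T W)))"
          using blade_sign_assoc[of T Q "sym_diff Q (sym_diff T W)"]
          unfolding *(1) *(2) sym_diff_cancel by (rule mult_rearrange)
      qed
      finally show "(\<Sum>S\<in>UNIV. blade_sign S (sym_diff S W) * blade_sign T (sym_diff T S) *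
          coeff a T * coeff b (sym_diff T S) * coeff c (sym_diff S W)) = \<dots>" .
    qed
    also have "\<dots> = coeff (a * (b * c)) W"
      by (simp add: times_cl33.rep_eq sum_distrib_left)
    finally show "coeff ((a * b) * c) W = coeff (a * (b * c)) W" .
  qed
  show "1 * a = a"
  proof (rule cl33_eqI)
    fix U
    have "coeff (1 * a) U = (\<Sum>S::6 set\<in>UNIV. if S = {} then coeff a U else 0)"
      unfolding times_cl33.rep_eq one_cl33.rep_eq by (rule sum.cong) auto
    then show "coeff (1 * a) U = coeff a U" by simp
  qed
  show "a * 1 = a"
  proof (rule cl33_eqI)
    fix U
    have *: "sym_diff S U = {} \<longleftrightarrow> S = U" for S :: "6 set" by auto
    have "coeff (a * 1) U = (\<Sum>S\<in>UNIV. if S = U then coeff a U else 0)"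
      unfolding times_cl33.rep_eq one_cl33.rep_eq * by (rule sum.cong) auto
    then show "coeff (a * 1) U = coeff a U" by simp
  qed
  show "(0::cl33) \<noteq> 1"
    by transfer (metis zero_neq_one)
  fix r :: real
  show "(r *\<^sub>R a) * b = r *\<^sub>R (a * b)" "a * (r *\<^sub>R b) = r *\<^sub>R (a * b)"
    by (transfer, simp add: sum_distrib_left mult_ac)+
  show "(a + b) * c = a * c + b * c" "a * (b + c) = a * b + a * c"
    by (transfer, simp add: algebra_simps sum.distrib)+
qed (transfer, simp add: algebra_simps)+

end

text \<open>The sum norm of the blade coefficients, for which the library exponential is available.\<close>

instantiation cl33 :: real_normed_algebra_1
begin

definition norm_cl33 :: "cl33 \<Rightarrow> real" where
  "norm_cl33 a = (\<Sum>S\<in>UNIV. \<bar>coeff a S\<bar>)"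

definition dist_cl33 :: "cl33 \<Rightarrow> cl33 \<Rightarrow> real" where
  "dist_cl33 a b = norm (a - b)"

definition sgn_cl33 :: "cl33 \<Rightarrow> cl33" where
  "sgn_cl33 a = a /\<^sub>R norm a"

definition uniformity_cl33 :: "(cl33 \<times> cl33) filter" where
  "uniformity_cl33 = (INF e\<in>{0<..}. principal {(x, y). dist x y < e})"

definition open_cl33 :: "cl33 set \<Rightarrow> bool" where
  "open_cl33 U \<longleftrightarrow> (\<forall>x\<in>U. \<forall>\<^sub>F (x', y) in uniformity. x' = x \<longrightarrow> y \<in> U)"

instance
proof
  fix a b :: cl33 and r :: real
  show "dist a b = norm (a - b)" by (simp add: dist_cl33_def)
  show "sgn a = a /\<^sub>R norm a" by (simp add: sgn_cl33_def)
  show "(uniformity :: (cl33 \<times> cl33) filter) = (INF e\<in>{0<..}. principal {(x, y). dist x y < e})"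
    by (simp add: uniformity_cl33_def)
  show "open U \<longleftrightarrow> (\<forall>x\<in>U. \<forall>\<^sub>F (x', y) in uniformity. x' = x \<longrightarrow> y \<in> U)" for U :: "cl33 set"
    by (simp add: open_cl33_def)
  show "norm a = 0 \<longleftrightarrow> a = 0"
    by (auto simp: norm_cl33_def sum_nonneg_eq_0_iff zero_cl33.rep_eq intro: cl33_eqI)
  show "norm (a + b) \<le> norm a + norm b"
    by (simp add: norm_cl33_def plus_cl33.rep_eq sum_mono abs_triangle_ineq flip: sum.distrib)
  show "norm (r *\<^sub>R a) = \<bar>r\<bar> * norm a"
    by (simp add: norm_cl33_def scaleR_cl33.rep_eq abs_mult sum_distrib_left)
  show "norm (1::cl33) = 1"
    by (simp add: norm_cl33_def one_cl33.rep_eq if_distrib[of abs] cong: if_cong)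
  have "norm (a * b) \<le> (\<Sum>U\<in>UNIV. \<Sum>S\<in>UNIV. \<bar>coeff a S\<bar> * \<bar>coeff b (sym_diff S U)\<bar>)"
    unfolding norm_cl33_def times_cl33.rep_eq
    by (intro sum_mono order_trans[OF sum_abs]) (simp add: abs_mult)
  also have "\<dots> = (\<Sum>S\<in>UNIV. \<Sum>U\<in>UNIV. \<bar>coeff a S\<bar> * \<bar>coeff b (sym_diff S U)\<bar>)"
    by (rule sum.swap)
  also have "\<dots> = (\<Sum>S\<in>UNIV. \<Sum>U\<in>UNIV. \<bar>coeff a S\<bar> * \<bar>coeff b U\<bar>)"
    by (intro sum.cong[OF refl] sum_sym_diff)
  also have "\<dots> = norm a * norm b"
    by (simp add: norm_cl33_def sum_product)
  finally show "norm (a * b) \<le> norm a * norm b" .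
qed

end

lemma abs_coeff_le_norm: "\<bar>coeff a S\<bar> \<le> norm a"
  unfolding norm_cl33_def by (rule member_le_sum) auto

instance cl33 :: banach
proof
  fix X :: "nat \<Rightarrow> cl33"
  assume X: "Cauchy X"
  define L where "L S = lim (\<lambda>n. coeff (X n) S)" for S
  have "Cauchy (\<lambda>n. coeff (X n) S)" for S
  proof (rule metric_CauchyI)
    fix e :: real assume "0 < e"
    then obtain N where N: "\<And>m n. m \<ge> N \<Longrightarrow> n \<ge> N \<Longrightarrow> dist (X m) (X n) < e"
      using metric_CauchyD[OF X] by blast
    have "dist (coeff (X m) S) (coeff (X n) S) \<le> dist (X m) (X n)" for m n
      using abs_coeff_le_norm[of "X m - X n" S]
      by (simp add: dist_real_def dist_cl33_def minus_cl33.rep_eq)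
    then show "\<exists>M. \<forall>m\<ge>M. \<forall>n\<ge>M. dist (coeff (X m) S) (coeff (X n) S) < e"
      using N by (meson le_less_trans)
  qed
  then have L: "(\<lambda>n. coeff (X n) S) \<longlonglongrightarrow> L S" for S
    unfolding L_def by (simp add: Cauchy_convergent_iff convergent_LIMSEQ_iff)
  have "(\<lambda>n. \<Sum>S\<in>UNIV. \<bar>coeff (X n) S - L S\<bar>) \<longlonglongrightarrow> (\<Sum>S\<in>UNIV. \<bar>L S - L S\<bar>)"
    by (intro tendsto_sum tendsto_rabs tendsto_diff L tendsto_const)
  then have "(\<lambda>n. dist (X n) (Cl33 L)) \<longlonglongrightarrow> 0"
    by (simp add: dist_cl33_def norm_cl33_def minus_cl33.rep_eq Cl33_inverse)
  then show "convergent X"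
    using tendsto_dist_iff convergentI by blast
qed

lift_definition blade :: "6 set \<Rightarrow> cl33" is "\<lambda>S T. if T = S then 1 else 0" .

lemma blade_mult: "blade S * blade T = blade_sign S T *\<^sub>R blade (sym_diff S T)"
proof (rule cl33_eqI)
  fix U
  have "coeff (blade S * blade T) U = (\<Sum>S'\<in>UNIV. if S' = S then
      (if sym_diff S U = T then blade_sign S (sym_diff S U) else 0) else 0)"
    unfolding times_cl33.rep_eq blade.rep_eq by (rule sum.cong) auto
  also have "\<dots> = (if sym_diff S U = T then blade_sign S (sym_diff S U) else 0)"
    by simp
  also have "\<dots> = coeff (blade_sign S T *\<^sub>R blade (sym_diff S T)) U"
    unfolding scaleR_cl33.rep_eq blade.rep_eq by auto
  finally show "coeff (blade S * blade T) U = coeff (blade_sign S T *\<^sub>R blade (sym_diff S T)) U" .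
qed

lemma blade_empty: "blade {} = 1"
  by (rule cl33_eqI) (simp add: blade.rep_eq one_cl33.rep_eq)

lemma cl33_expand: "a = (\<Sum>S\<in>UNIV. coeff a S *\<^sub>R blade S)"
proof (rule cl33_eqI)
  fix T
  have "coeff (\<Sum>S\<in>A. coeff a S *\<^sub>R blade S) T = (\<Sum>S\<in>A. coeff a S * coeff (blade S) T)" for A
    by (induction A rule: infinite_finite_induct)
      (simp_all add: zero_cl33.rep_eq plus_cl33.rep_eq scaleR_cl33.rep_eq)
  then show "coeff a T = coeff (\<Sum>S\<in>UNIV. coeff a S *\<^sub>R blade S) T"
    by (simp add: blade.rep_eq if_distrib cong: if_cong)
qed

definition gen :: "6 \<Rightarrow> cl33" where
  "gen k = blade {k}"

lemma gen_square: "gen k * gen k = metric k *\<^sub>R 1"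
  by (simp add: gen_def blade_mult blade_sign_def blade_empty)

lemma gen_anticommute:
  assumes "j \<noteq> k" shows "gen j * gen k = - (gen k * gen j)"
proof -
  have "sym_diff {j} {k} = sym_diff {k} {j}" by auto
  moreover have "{j} \<inter> {k} = {}" "{k} \<inter> {j} = {}" using assms by auto
  ultimately show ?thesis
    using assms
    by (cases j k rule: linorder_cases)
      (auto simp: gen_def blade_mult blade_sign_def dest: less_asym)
qed

lemma blade_insert:
  assumes "\<And>s. s \<in> S \<Longrightarrow> k < s"
  shows "blade (insert k S) = gen k * blade S"
proof -
  have "k \<notin> S" using assms by blast
  then have "sym_diff {k} S = insert k S" "{k} \<inter> S = {}" by auto
  moreover have "(\<Prod>t\<in>S. if t < k then - 1 else (1::real)) = 1"
    by (rule prod.neutral) (use assms in force)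
  ultimately show ?thesis
    by (simp add: gen_def blade_mult blade_sign_def)
qed

lemma blade_eq_prod_list: "blade S = prod_list (map gen (sorted_list_of_set S))"
proof (induction "card S" arbitrary: S)
  case 0
  then show ?case by (simp add: blade_empty)
next
  case (Suc n)
  then have "S \<noteq> {}" by auto
  define k where "k = Min S"
  have k: "k \<in> S" "\<And>s. s \<in> S - {k} \<Longrightarrow> k < s"
    using \<open>S \<noteq> {}\<close> by (auto simp: k_def order.not_eq_order_implies_strict)
  have "blade S = gen k * blade (S - {k})"
    using blade_insert[of "S - {k}" k] k by (simp add: insert_absorb)
  also have "blade (S - {k}) = prod_list (map gen (sorted_list_of_set (S - {k})))"
    using Suc k(1) by (intro Suc.hyps(1)) simp
  also have "gen k * \<dots> = prod_list (map gen (sorted_list_of_set S))"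
    using \<open>S \<noteq> {}\<close> by (simp add: sorted_list_of_set_nonempty k_def)
  finally show ?case .
qed

definition even_cl :: "cl33 \<Rightarrow> bool" where
  "even_cl a \<longleftrightarrow> (\<forall>S. odd (card S) \<longrightarrow> coeff a S = 0)"

definition invertible_cl :: "cl33 \<Rightarrow> bool" where
  "invertible_cl a \<longleftrightarrow> (\<exists>b. a * b = 1 \<and> b * a = 1)"

definition inverse_cl :: "cl33 \<Rightarrow> cl33" where
  "inverse_cl a = (THE b. a * b = 1 \<and> b * a = 1)"

lemma inverse_cl_unique:
  assumes "a * b = 1" "b * a = 1" shows "inverse_cl a = b"
  unfolding inverse_cl_def
proof (rule the_equality)
  show "c = b" if "a * c = 1 \<and> c * a = 1" for c
    by (metis assms(2) mult.assoc mult.left_neutral mult.right_neutral that)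
qed (use assms in simp)

definition outer :: "cl33 \<Rightarrow> cl33 \<Rightarrow> cl33" where
  "outer a b = (1 / 2) *\<^sub>R (a * b - b * a)"  \<comment> \<open>the wedge product, for vectors only\<close>


text \<open>
  The pair \<open>(a, b)\<close> stands for the element with coordinates \<open>a\<close> along E_1, E_2, E_3 and
  \<open>b\<close> along E_1', E_2', E_3' of the second exterior power of 4-space.
\<close>

type_synonym r33 = "(real^3) \<times> (real^3)"

definition form33 :: "r33 \<Rightarrow> r33 \<Rightarrow> real" where
  "form33 X Y = fst X \<bullet> snd Y + snd X \<bullet> fst Y"

text \<open>
  The null basis: \<open>E i\<close> and \<open>E' i\<close> are the normalised sum and difference of the i-th generator of
  square 1 and the i-th generator of square -1, so that their inner product is 1; see
  \<open>vec33_square\<close>.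
\<close>

definition gen_index :: "3 \<Rightarrow> 6" where
  "gen_index i = (if i = 1 then 0 else if i = 2 then 1 else 2)"

definition E :: "3 \<Rightarrow> cl33" where
  "E i = (1 / sqrt 2) *\<^sub>R (gen (gen_index i) + gen (gen_index i + 3))"

definition E' :: "3 \<Rightarrow> cl33" where
  "E' i = (1 / sqrt 2) *\<^sub>R (gen (gen_index i) - gen (gen_index i + 3))"

definition vec33 :: "r33 \<Rightarrow> cl33" where
  "vec33 X = (\<Sum>i\<in>UNIV. fst X $ i *\<^sub>R E i + snd X $ i *\<^sub>R E' i)"

definition e4 :: "4 \<Rightarrow> real^4" where
  "e4 i = axis i 1"

definition spatial :: "real^4 \<Rightarrow> real^3" where
  "spatial X = vector [X $ 1, X $ 2, X $ 3]"

text \<open>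
  The exterior product of two vectors of 4-space, whose coordinates have indices 0, 1, 2, 3
  (in the index type 4, the numeral 4 is 0). The E_i part has the components
  \<open>X\<^sub>0 Y\<^sub>i - X\<^sub>i Y\<^sub>0\<close>; the E_i' part has those of the cross product, because E_1', E_2', E_3' are
  e_2 \<and> e_3, e_3 \<and> e_1, e_1 \<and> e_2.
\<close>

definition wedge4 :: "real^4 \<Rightarrow> real^4 \<Rightarrow> r33" where
  "wedge4 X Y = (X $ 0 *\<^sub>R spatial Y - Y $ 0 *\<^sub>R spatial X, cross3 (spatial X) (spatial Y))"

lemma wedge4_basis:
  "wedge4 (e4 0) (e4 1) = (axis 1 1, 0)" "wedge4 (e4 0) (e4 2) = (axis 2 1, 0)"
  "wedge4 (e4 0) (e4 3) = (axis 3 1, 0)" "wedge4 (e4 2) (e4 3) = (0, axis 1 1)"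
  "wedge4 (e4 3) (e4 1) = (0, axis 2 1)" "wedge4 (e4 1) (e4 2) = (0, axis 3 1)"
  by (simp_all add: wedge4_def e4_def spatial_def vec_eq_iff forall_3 cross3_def axis_def)

lemma wedge4_self: "wedge4 X X = 0"
  by (simp add: wedge4_def zero_prod_def)

lemma linear_spatial: "linear spatial"
  by (rule linearI) (simp_all add: spatial_def vec_eq_iff forall_3)

lemma bilinear_wedge4: "bilinear wedge4"
  using linear_add[OF linear_spatial] linear_scale[OF linear_spatial]
  by (auto simp: bilinear_def wedge4_def algebra_simps cross3_def
      vec_eq_iff forall_3 intro!: linearI)

lemma gen_index_simps:
  "gen_index i = gen_index j \<longleftrightarrow> i = j" "gen_index i + 3 = gen_index j + 3 \<longleftrightarrow> i = j"
  "gen_index i \<noteq> gen_index j + 3" "gen_index i + 3 \<noteq> gen_index j"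
  "metric (gen_index i) = 1" "metric (gen_index i + 3) = - 1"
proof -
  have "(0::6) < 3" "(1::6) < 3" "(2::6) < 3" "\<not> (3::6) < 3" "\<not> (4::6) < 3" "\<not> (5::6) < 3"
    by (simp_all add: less_bit0_def bit0.Rep_numeral bit0.Rep_0 bit0.Rep_1)
  then show "gen_index i = gen_index j \<longleftrightarrow> i = j" "gen_index i + 3 = gen_index j + 3 \<longleftrightarrow> i = j"
    "gen_index i \<noteq> gen_index j + 3" "gen_index i + 3 \<noteq> gen_index j"
    "metric (gen_index i) = 1" "metric (gen_index i + 3) = - 1"
    using exhaust_3[of i] exhaust_3[of j] by (auto simp: gen_index_def metric_def)
qed

lemma gen_anticommutator:
  "gen j * gen k + gen k * gen j = (if j = k then 2 * metric k else 0) *\<^sub>R 1"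
  by (simp add: gen_square gen_anticommute[of j k] scaleR_2[symmetric])

lemma E_anticommutator:
  "E i * E j + E j * E i = 0"
  "E' i * E' j + E' j * E' i = 0"
  "E i * E' j + E' j * E i = (if i = j then 2 else 0) *\<^sub>R 1"
proof -
  let ?p = "\<lambda>i. gen (gen_index i)" and ?n = "\<lambda>i. gen (gen_index i + 3)"
  have ac: "?p i * ?p j + ?p j * ?p i = (if i = j then 2 else 0) *\<^sub>R 1"
    "?n i * ?n j + ?n j * ?n i = (if i = j then - 2 else 0) *\<^sub>R 1"
    "?p i * ?n j + ?n j * ?p i = 0" "?n i * ?p j + ?p j * ?n i = 0"
    by (simp_all add: gen_anticommutator gen_index_simps)
  have "E i * E j + E j * E i = (1 / 2) *\<^sub>R ((?p i * ?p j + ?p j * ?p i) + (?n i * ?n j + ?n j * ?n i)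
      + (?p i * ?n j + ?n j * ?p i) + (?n i * ?p j + ?p j * ?n i))"
    by (simp add: E_def algebra_simps)
  then show "E i * E j + E j * E i = 0" unfolding ac by simp
  have "E' i * E' j + E' j * E' i = (1 / 2) *\<^sub>R ((?p i * ?p j + ?p j * ?p i) + (?n i * ?n j + ?n j * ?n i)
      - (?p i * ?n j + ?n j * ?p i) - (?n i * ?p j + ?p j * ?n i))"
    by (simp add: E'_def algebra_simps)
  then show "E' i * E' j + E' j * E' i = 0" unfolding ac by simp
  have "E i * E' j + E' j * E i = (1 / 2) *\<^sub>R ((?p i * ?p j + ?p j * ?p i) - (?n i * ?n j + ?n j * ?n i)
      - (?p i * ?n j + ?n j * ?p i) + (?n i * ?p j + ?p j * ?n i))"
    by (simp add: E_def E'_def algebra_simps)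
  then show "E i * E' j + E' j * E i = (if i = j then 2 else 0) *\<^sub>R 1"
    unfolding ac by (auto simp: scaleR_left.add[symmetric])
qed

lemma linear_vec33: "linear vec33"
  by (rule linearI)
    (simp_all add: vec33_def scaleR_add_left scaleR_add_right sum.distrib scaleR_sum_right)

lemma vec33_E: "vec33 (axis i 1, 0) = E i" "vec33 (0, axis i 1) = E' i"
  by (simp_all add: vec33_def axis_def if_distrib[of "\<lambda>r. r *\<^sub>R _"] cong: if_cong)

lemma vec33_E_anticommutator:
  "vec33 X * E i + E i * vec33 X = (2 * snd X $ i) *\<^sub>R 1"
  "vec33 X * E' i + E' i * vec33 X = (2 * fst X $ i) *\<^sub>R 1"
proof -
  have "vec33 X * E i + E i * vec33 X =
      (\<Sum>j\<in>UNIV. fst X $ j *\<^sub>R (E j * E i + E i * E j) + snd X $ j *\<^sub>R (E i * E' j + E' j * E i))"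
    by (simp add: vec33_def sum_distrib_left sum_distrib_right algebra_simps flip: sum.distrib)
  also have "\<dots> = (\<Sum>j\<in>UNIV. if i = j then (2 * snd X $ j) *\<^sub>R 1 else 0)"
    unfolding E_anticommutator by (intro sum.cong) auto
  finally show "vec33 X * E i + E i * vec33 X = (2 * snd X $ i) *\<^sub>R 1"
    by simp
  have "vec33 X * E' i + E' i * vec33 X =
      (\<Sum>j\<in>UNIV. fst X $ j *\<^sub>R (E j * E' i + E' i * E j) + snd X $ j *\<^sub>R (E' j * E' i + E' i * E' j))"
    by (simp add: vec33_def sum_distrib_left sum_distrib_right algebra_simps flip: sum.distrib)
  also have "\<dots> = (\<Sum>j\<in>UNIV. if i = j then (2 * fst X $ j) *\<^sub>R 1 else 0)"
    unfolding E_anticommutator by (intro sum.cong) auto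
  finally show "vec33 X * E' i + E' i * vec33 X = (2 * fst X $ i) *\<^sub>R 1"
    by simp
qed

lemma vec33_anticommutator:
  "vec33 X * vec33 Y + vec33 Y * vec33 X = (2 * form33 X Y) *\<^sub>R 1"
proof -
  have "vec33 X * vec33 Y + vec33 Y * vec33 X =
     (\<Sum>i\<in>UNIV. fst Y $ i *\<^sub>R (vec33 X * E i + E i * vec33 X) + snd Y $ i *\<^sub>R (vec33 X * E' i + E' i * vec33 X))"
    by (subst (1 2) vec33_def[of Y])
      (simp add: sum_distrib_left sum_distrib_right algebra_simps flip: sum.distrib)
  also have "\<dots> = (\<Sum>i\<in>UNIV. (2 * (fst X $ i * snd Y $ i + snd X $ i * fst Y $ i)) *\<^sub>R 1)"
    unfolding vec33_E_anticommutator by (intro sum.cong refl) (simp add: algebra_simps)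
  finally show ?thesis
    by (simp add: form33_def inner_vec_def sum.distrib sum_distrib_left algebra_simps
        flip: scaleR_sum_left)
qed

lemma vec33_square: "vec33 X * vec33 X = form33 X X *\<^sub>R 1"
proof -
  have "2 *\<^sub>R (vec33 X * vec33 X) = 2 *\<^sub>R (form33 X X *\<^sub>R 1)"
    using vec33_anticommutator[of X X] by (simp add: scaleR_2)
  then show ?thesis
    by (simp del: scaleR_scaleR)
qed

lemma inj_vec33: "inj vec33"
proof (rule injI)
  fix X Y assume eq: "vec33 X = vec33 Y"
  have "snd X $ i = snd Y $ i" "fst X $ i = fst Y $ i" for i
    using vec33_E_anticommutator[of X i] vec33_E_anticommutator[of Y i] unfolding eq by simp_all
  then show "X = Y" by (simp add: prod_eq_iff vec_eq_iff)
qed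

definition EpEp :: "real^3 \<Rightarrow> cl33" where
  "EpEp x = x $ 1 *\<^sub>R outer (E' 2) (E' 3) + x $ 2 *\<^sub>R outer (E' 3) (E' 1) + x $ 3 *\<^sub>R outer (E' 1) (E' 2)"

definition EltEp :: "real^3 \<Rightarrow> cl33" where
  "EltEp x = x $ 1 *\<^sub>R outer (E 2) (E' 3) + x $ 2 *\<^sub>R outer (E 3) (E' 1) + x $ 3 *\<^sub>R outer (E 1) (E' 2)"

definition EgtEp :: "real^3 \<Rightarrow> cl33" where
  "EgtEp x = x $ 1 *\<^sub>R outer (E 3) (E' 2) + x $ 2 *\<^sub>R outer (E 1) (E' 3) + x $ 3 *\<^sub>R outer (E 2) (E' 1)"

definition bivectors :: "cl33 set" where
  "bivectors = span {outer (vec33 X) (vec33 Y) | X Y. True}"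

text \<open>
  The linear action of \<open>M \<otimes> I + I \<otimes> M\<close> on the second exterior power, given by its values on the
  basis; see \<open>ext2_wedge4\<close>.
\<close>

definition ext2 :: "real^4^4 \<Rightarrow> r33 \<Rightarrow> r33" where
  "ext2 M X =
    (let D = (\<lambda>i j. wedge4 (M *v e4 i) (e4 j) + wedge4 (e4 i) (M *v e4 j)) in
      fst X $ 1 *\<^sub>R D 0 1 + fst X $ 2 *\<^sub>R D 0 2 + fst X $ 3 *\<^sub>R D 0 3 +
      snd X $ 1 *\<^sub>R D 2 3 + snd X $ 2 *\<^sub>R D 3 1 + snd X $ 3 *\<^sub>R D 1 2)"

lemma sum_UNIV_4: "(\<Sum>i\<in>UNIV. f (i :: 4)) = f 0 + f 1 + f 2 + f 3"
proof -
  have "(4 :: 4) = 0" by simp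
  then show ?thesis
    unfolding sum_4 by (simp only: add_ac)
qed

lemma matrix_vector_mult_4:
  "((M :: real^4^4) *v X) $ i = M $ i $ 0 * X $ 0 + M $ i $ 1 * X $ 1 + M $ i $ 2 * X $ 2 + M $ i $ 3 * X $ 3"
  by (simp add: matrix_vector_mult_def sum_UNIV_4)

lemma e4_nth: "e4 j $ i = (if i = j then 1 else 0)"
  by (simp add: e4_def axis_def)

lemma spatial_nth: "spatial X $ 1 = X $ 1" "spatial X $ 2 = X $ 2" "spatial X $ 3 = X $ 3"
  by (simp_all add: spatial_def)

lemma ext2_wedge4: "ext2 M (wedge4 X Y) = wedge4 (M *v X) Y + wedge4 X (M *v Y)"
  unfolding prod_eq_iff vec_eq_iff forall_3
  apply (simp add: ext2_def Let_def wedge4_def cross3_def spatial_nth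
      matrix_vector_mult_4 e4_nth)
  apply (intro conjI; algebra)
  done

definition sl4 :: "(real^4^4) set" where
  "sl4 = {M. trace M = 0}"

definition is_bivector_form :: "real^4^4 \<Rightarrow> cl33 \<Rightarrow> bool" where
  "is_bivector_form M B \<longleftrightarrow>
    B \<in> bivectors \<and> (\<forall>X. B * vec33 X - vec33 X * B = vec33 (ext2 M X))"

text \<open>Well defined for \<open>M \<in> sl4\<close> by \<open>ex1_bivector_form\<close>.\<close>

definition bivector_form :: "real^4^4 \<Rightarrow> cl33" where
  "bivector_form M = (THE B. is_bivector_form M B)"

lemma linear_ext2: "linear (ext2 M)"
  by (rule linearI) (simp_all add: ext2_def Let_def scaleR_add_left scaleR_add_right)

lemma ext2_skew: "form33 (ext2 M X) Y + form33 X (ext2 M Y) = trace M * form33 X Y"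
  apply (simp add: ext2_def Let_def wedge4_def cross3_def spatial_nth form33_def inner_vec_def
      matrix_vector_mult_4 e4_nth sum_3 trace_def sum_UNIV_4)
  apply algebra
  done

lemma outer_vec33_commutator:
  "outer (vec33 A) (vec33 B) * vec33 X - vec33 X * outer (vec33 A) (vec33 B) =
    vec33 ((2 * form33 B X) *\<^sub>R A - (2 * form33 A X) *\<^sub>R B)"
proof -
  have *: "(vec33 A * vec33 B) * vec33 X - vec33 X * (vec33 A * vec33 B) =
    vec33 ((2 * form33 B X) *\<^sub>R A - (2 * form33 A X) *\<^sub>R B)" for A B
  proof -
    have "(vec33 A * vec33 B) * vec33 X - vec33 X * (vec33 A * vec33 B) =
      vec33 A * (vec33 B * vec33 X + vec33 X * vec33 B) -
      (vec33 A * vec33 X + vec33 X * vec33 A) * vec33 B"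
      by (simp add: algebra_simps)
    also have "\<dots> = (2 * form33 B X) *\<^sub>R vec33 A - (2 * form33 A X) *\<^sub>R vec33 B"
      unfolding vec33_anticommutator by simp
    finally show ?thesis
      by (simp add: linear_diff[OF linear_vec33] linear_scale[OF linear_vec33])
  qed
  have "outer (vec33 A) (vec33 B) * vec33 X - vec33 X * outer (vec33 A) (vec33 B) =
     (1 / 2) *\<^sub>R (((vec33 A * vec33 B) * vec33 X - vec33 X * (vec33 A * vec33 B)) -
       ((vec33 B * vec33 A) * vec33 X - vec33 X * (vec33 B * vec33 A)))"
    by (simp add: outer_def algebra_simps)
  also have "\<dots> = vec33 ((1 / 2) *\<^sub>R (((2 * form33 B X) *\<^sub>R A - (2 * form33 A X) *\<^sub>R B) -
      ((2 * form33 A X) *\<^sub>R B - (2 * form33 B X) *\<^sub>R A)))"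
    unfolding * by (simp only: linear_diff[OF linear_vec33] linear_scale[OF linear_vec33])
  also have "(1 / 2) *\<^sub>R (((2 * form33 B X) *\<^sub>R A - (2 * form33 A X) *\<^sub>R B) -
      ((2 * form33 A X) *\<^sub>R B - (2 * form33 B X) *\<^sub>R A)) =
      (2 * form33 B X) *\<^sub>R A - (2 * form33 A X) *\<^sub>R B"
    by (simp add: prod_eq_iff vec_eq_iff)
  finally show ?thesis .
qed

lemma bilinear_outer: "bilinear outer"
  by (auto simp: bilinear_def outer_def algebra_simps intro!: linearI)

lemma r33_expand:
  "(\<Sum>i\<in>UNIV. (fst X $ i) *\<^sub>R (axis i 1, 0) + (snd X $ i) *\<^sub>R (0, axis i 1)) = (X :: r33)"
  by (simp add: prod_eq_iff vec_eq_iff forall_3 sum_3 axis_def)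

lemma form33_axis:
  "form33 X (axis i 1, 0) = snd X $ i" "form33 X (0, axis i 1) = fst X $ i"
  by (simp_all add: form33_def inner_axis)

definition biv_of :: "(cl33 \<Rightarrow> cl33) \<Rightarrow> cl33" where
  "biv_of f = (1 / 4) *\<^sub>R (\<Sum>i\<in>UNIV. outer (f (E i)) (E' i) + outer (f (E' i)) (E i))"

lemma linear_biv_of: "biv_of (\<lambda>x. f x + g x) = biv_of f + biv_of g"
  "biv_of (\<lambda>x. r *\<^sub>R f x) = r *\<^sub>R biv_of f"
  by (simp_all add: biv_of_def bilinear_ladd[OF bilinear_outer] bilinear_lmul[OF bilinear_outer]
      sum.distrib scaleR_sum_right scaleR_add_right)

lemma biv_of_commutator:
  assumes "B \<in> bivectors" shows "biv_of (\<lambda>x. B * x - x * B) = B"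
  using assms unfolding bivectors_def
proof (induction rule: span_induct_alt)
  case base
  then show ?case by (simp add: biv_of_def outer_def)
next
  case (step r b B)
  obtain P Q where b: "b = outer (vec33 P) (vec33 Q)" using step by blast
  have ad: "b * E i - E i * b = vec33 ((2 * snd Q $ i) *\<^sub>R P - (2 * snd P $ i) *\<^sub>R Q)"
    "b * E' i - E' i * b = vec33 ((2 * fst Q $ i) *\<^sub>R P - (2 * fst P $ i) *\<^sub>R Q)" for i
    unfolding b vec33_E[symmetric] outer_vec33_commutator form33_axis by simp_all
  have exp: "(\<Sum>i\<in>UNIV. outer z (snd X $ i *\<^sub>R E' i + fst X $ i *\<^sub>R E i)) = outer z (vec33 X)" for z X
    unfolding linear_sum[OF bilinear_outer[unfolded bilinear_def, THEN conjunct1, rule_format], symmetric]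
    by (simp add: vec33_def add.commute)
  have "biv_of (\<lambda>x. b * x - x * b) = (1 / 2) *\<^sub>R (\<Sum>i\<in>UNIV.
      outer (vec33 P) (snd Q $ i *\<^sub>R E' i + fst Q $ i *\<^sub>R E i) -
      outer (vec33 Q) (snd P $ i *\<^sub>R E' i + fst P $ i *\<^sub>R E i))"
    unfolding biv_of_def ad
    by (simp add: linear_diff[OF linear_vec33] linear_scale[OF linear_vec33] sum_3
        bilinear_ladd[OF bilinear_outer] bilinear_lmul[OF bilinear_outer]
        bilinear_lsub[OF bilinear_outer] bilinear_radd[OF bilinear_outer]
        bilinear_rmul[OF bilinear_outer] algebra_simps)
  also have "\<dots> = (1 / 2) *\<^sub>R (outer (vec33 P) (vec33 Q) - outer (vec33 Q) (vec33 P))"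
    unfolding sum_subtractf exp ..
  also have "\<dots> = b"
  proof -
    have "outer (vec33 Q) (vec33 P) = - b" by (simp add: b outer_def algebra_simps)
    then show ?thesis by (simp add: b[symmetric] scaleR_2[symmetric])
  qed
  finally have "biv_of (\<lambda>x. b * x - x * b) = b" .
  moreover have "(\<lambda>x. (r *\<^sub>R b + B) * x - x * (r *\<^sub>R b + B)) =
      (\<lambda>x. r *\<^sub>R (b * x - x * b) + (B * x - x * B))"
    by (simp add: algebra_simps)
  ultimately show ?case
    using step by (simp only: linear_biv_of)
qed

lemma bivector_form_unique:
  assumes "is_bivector_form M B" "is_bivector_form M C" shows "B = C"
proof -
  have "B * E i - E i * B = C * E i - E i * C" "B * E' i - E' i * B = C * E' i - E' i * C" for i
    using assms unfolding is_bivector_form_def vec33_E[symmetric] by auto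
  then have "biv_of (\<lambda>x. B * x - x * B) = biv_of (\<lambda>x. C * x - x * C)"
    by (simp add: biv_of_def)
  then show ?thesis
    using assms by (simp add: is_bivector_form_def biv_of_commutator)
qed

lemma bivector_form_exists:
  assumes "M \<in> sl4" shows "\<exists>B. is_bivector_form M B"
proof
  let ?f = "ext2 M"
  define B where "B = (1 / 4) *\<^sub>R (\<Sum>i\<in>UNIV. outer (vec33 (?f (axis i 1, 0))) (vec33 (0, axis i 1)) +
    outer (vec33 (?f (0, axis i 1))) (vec33 (axis i 1, 0)))"
  have skew: "form33 (?f Y) X = - form33 Y (?f X)" for X Y
    using ext2_skew[of M Y X] assms by (simp add: sl4_def)
  have "B \<in> bivectors"
    unfolding B_def bivectors_def by (intro span_scale span_sum span_add span_base) blast+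
  moreover have "B * vec33 X - vec33 X * B = vec33 (?f X)" for X
  proof -
    have com: "form33 (axis i 1, 0) X = snd X $ i" "form33 (0, axis i 1) X = fst X $ i" for i X
      by (simp_all add: form33_def inner_axis inner_axis')
    have vec: "((2 * x) *\<^sub>R u - (2 * - q) *\<^sub>R b) + ((2 * y) *\<^sub>R w - (2 * - p) *\<^sub>R a) =
        2 *\<^sub>R (x *\<^sub>R u + y *\<^sub>R w) + 2 *\<^sub>R (p *\<^sub>R a + q *\<^sub>R b)" for x y p q and u w a b :: r33
      by (simp add: algebra_simps)
    have "B * vec33 X - vec33 X * B = (1 / 4) *\<^sub>R (\<Sum>i\<in>UNIV.
        (outer (vec33 (?f (axis i 1, 0))) (vec33 (0, axis i 1)) * vec33 X -
          vec33 X * outer (vec33 (?f (axis i 1, 0))) (vec33 (0, axis i 1))) +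
        (outer (vec33 (?f (0, axis i 1))) (vec33 (axis i 1, 0)) * vec33 X -
          vec33 X * outer (vec33 (?f (0, axis i 1))) (vec33 (axis i 1, 0))))"
      by (simp add: B_def sum_distrib_left sum_distrib_right algebra_simps sum.distrib sum_subtractf)
    also have "\<dots> = vec33 ((1 / 4) *\<^sub>R (\<Sum>i\<in>UNIV.
        2 *\<^sub>R ?f ((fst X $ i) *\<^sub>R (axis i 1, 0) + (snd X $ i) *\<^sub>R (0, axis i 1)) +
        2 *\<^sub>R ((fst (?f X) $ i) *\<^sub>R (axis i 1, 0) + (snd (?f X) $ i) *\<^sub>R (0, axis i 1))))"
    proof -
      have "((2 * form33 (0, axis i 1) X) *\<^sub>R ?f (axis i 1, 0) - (2 * form33 (?f (axis i 1, 0)) X) *\<^sub>R (0, axis i 1)) +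
          ((2 * form33 (axis i 1, 0) X) *\<^sub>R ?f (0, axis i 1) - (2 * form33 (?f (0, axis i 1)) X) *\<^sub>R (axis i 1, 0)) =
          2 *\<^sub>R ?f ((fst X $ i) *\<^sub>R (axis i 1, 0) + (snd X $ i) *\<^sub>R (0, axis i 1)) +
          2 *\<^sub>R ((fst (?f X) $ i) *\<^sub>R (axis i 1, 0) + (snd (?f X) $ i) *\<^sub>R (0, axis i 1))" for i
        unfolding skew com linear_add[OF linear_ext2] linear_scale[OF linear_ext2]
        by (rule vec)
      then show ?thesis
        unfolding outer_vec33_commutator
        by (simp only: linear_add[OF linear_vec33, symmetric] linear_sum[OF linear_vec33, symmetric]
            linear_scale[OF linear_vec33, symmetric])
    qed
    also have "\<dots> = vec33 ((1 / 4) *\<^sub>R (2 *\<^sub>R ?f X + 2 *\<^sub>R ?f X))"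
    proof -
      have "(\<Sum>i\<in>UNIV. 2 *\<^sub>R ?f (a i) + 2 *\<^sub>R b i) = 2 *\<^sub>R ?f (sum a UNIV) + 2 *\<^sub>R sum b UNIV"
        for a b :: "3 \<Rightarrow> r33"
        by (simp only: sum.distrib scaleR_sum_right linear_sum[OF linear_ext2])
      then show ?thesis
        by (simp only: r33_expand)
    qed
    finally show ?thesis
      by (simp flip: scaleR_add_left)
  qed
  ultimately show "is_bivector_form M B" by (simp add: is_bivector_form_def)
qed

lemma ex1_bivector_form: "M \<in> sl4 \<Longrightarrow> \<exists>!B. is_bivector_form M B"
  using bivector_form_exists bivector_form_unique by blast

lemma is_bivector_form_bivector_form: "M \<in> sl4 \<Longrightarrow> is_bivector_form M (bivector_form M)"
  unfolding bivector_form_def by (rule theI'[OF ex1_bivector_form])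

definition space_index :: "4 \<Rightarrow> 3" where
  "space_index i = (if i = 1 then 1 else if i = 2 then 2 else 3)"

text \<open>The block matrix with rows \<open>(s, 0)\<close> and \<open>(t, R)\<close>; see \<open>block4_mult\<close>.\<close>

definition block4 :: "real \<Rightarrow> real^3 \<Rightarrow> real^3^3 \<Rightarrow> real^4^4" where
  "block4 s t R = (\<chi> i j.
     if i = 0 then (if j = 0 then s else 0)
     else if j = 0 then t $ space_index i else R $ space_index i $ space_index j)"

lemma block4_mult:
  "(block4 s t R *v X) $ 0 = s * X $ 0"
  "spatial (block4 s t R *v X) = X $ 0 *\<^sub>R t + R *v spatial X"
  by (simp_all add: block4_def spatial_def space_index_def matrix_vector_mult_def sum_UNIV_4 sum_3
      vec_eq_iff forall_3 algebra_simps)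

definition se3 :: "(real^4^4) set" where
  "se3 = {block4 0 t (matrix (cross3 v)) | t v. True}"

lemma se3_subset_sl4: "se3 \<subseteq> sl4"
  by (auto simp: se3_def sl4_def trace_def block4_def sum_UNIV_4 space_index_def matrix_def
      cross3_def axis_def)

text \<open>Right-handed rotation by the angle \<open>\<alpha>\<close> about the unit vector \<open>v\<close> (Rodrigues formula).\<close>

definition axis_rotation :: "real^3 \<Rightarrow> real \<Rightarrow> real^3^3" where
  "axis_rotation v \<alpha> =
    matrix (\<lambda>x. cos \<alpha> *\<^sub>R x + sin \<alpha> *\<^sub>R cross3 v x + ((1 - cos \<alpha>) * (v \<bullet> x)) *\<^sub>R v)"

lemma axis_rotation_apply:
  "axis_rotation v \<alpha> *v x =
    cos \<alpha> *\<^sub>R x + sin \<alpha> *\<^sub>R cross3 v x + ((1 - cos \<alpha>) * (v \<bullet> x)) *\<^sub>R v"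
proof -
  have "linear (\<lambda>x. cos \<alpha> *\<^sub>R x + sin \<alpha> *\<^sub>R cross3 v x + ((1 - cos \<alpha>) * (v \<bullet> x)) *\<^sub>R v)"
    by (rule linearI) (simp_all add: cross_add_right cross_mult_right inner_add_right algebra_simps)
  then show ?thesis
    unfolding axis_rotation_def by (simp add: matrix_works linear_matrix_vector_mul_eq)
qed

lemma axis_rotation_axis: "norm v = 1 \<Longrightarrow> axis_rotation v \<alpha> *v v = v"
  by (simp add: axis_rotation_apply norm_eq_1 algebra_simps)

lemma axis_rotation_orthogonal:
  "v \<bullet> x = 0 \<Longrightarrow> axis_rotation v \<alpha> *v x = cos \<alpha> *\<^sub>R x + sin \<alpha> *\<^sub>R cross3 v x"
  by (simp add: axis_rotation_apply)

lemma rotation_matrix_axis_rotation: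
  assumes "norm v = 1" shows "rotation_matrix (axis_rotation v \<alpha>)"
proof -
  have v: "v $ 1 * v $ 1 + v $ 2 * v $ 2 + v $ 3 * v $ 3 = 1"
    using assms by (simp add: norm_eq_1 inner_vec_def sum_3)
  have cs: "cos \<alpha> * cos \<alpha> + sin \<alpha> * sin \<alpha> = 1"
    using sin_cos_squared_add2[of \<alpha>] by (simp add: power2_eq_square)
  have nth: "axis_rotation v \<alpha> $ i $ j = (axis_rotation v \<alpha> *v axis j 1) $ i" for i j
    by (simp add: matrix_vector_mult_basis column_def)
  note R = nth axis_rotation_apply cross3_def inner_vec_def sum_3 axis_def
  have "transpose (axis_rotation v \<alpha>) ** axis_rotation v \<alpha> = mat 1"
    unfolding vec_eq_iff forall_3
    apply (simp add: matrix_matrix_mult_def transpose_def mat_def R)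
    using v cs apply (intro conjI; algebra)
    done
  moreover have "det (axis_rotation v \<alpha>) = 1"
    apply (simp add: det_3 R)
    using v cs apply algebra
    done
  ultimately show ?thesis
    by (simp add: rotation_matrix_def orthogonal_matrix)
qed

definition null_3space :: "real^4 \<Rightarrow> cl33 set" where
  "null_3space X = {vec33 (wedge4 X Y) | Y. True}"

definition induces_motion :: "cl33 \<Rightarrow> real^3^3 \<Rightarrow> real^3 \<Rightarrow> bool" where
  "induces_motion U R t \<longleftrightarrow>
    even_cl U \<and> invertible_cl U \<and>
    (\<forall>X. X \<noteq> 0 \<longrightarrow>
      (\<lambda>Z. U * Z * inverse_cl U) ` null_3space X = null_3space (block4 1 t R *v X))"

end

theory Submission
  imports Defs
begin

text \<open>
  The exponent \<open>B\<close> is the bivector form of the twist \<open>M\<close> with angular velocity \<open>\<theta> v\<close> and linear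
  velocity \<open>w = \<theta> c \<times> v + d v\<close>, so its commutator with bivectors of 4-space is the derivation
  extending \<open>M\<close>. Hence, if two curves \<open>\<xi>\<close> and \<open>\<eta>\<close> in 4-space solve \<open>\<xi>' = M \<xi>\<close>, then
  \<open>exp (-s B) (\<xi>(s) \<and> \<eta>(s)) exp (s B)\<close> has derivative zero. The flow of \<open>M\<close> is the screw motion
  \<open>p \<mapsto> R_{s\<theta>} (p - c) + c + s d v\<close>, and \<open>c\<close> is chosen so that \<open>c - R c\<close> is the component of \<open>t\<close>
  orthogonal to \<open>v\<close>; at \<open>s = 1\<close> the flow is therefore \<open>p \<mapsto> R p + t\<close>.
\<close>

section \<open>Parity in the Clifford algebra\<close>

lemma coeff_vec33_even: "even (card S) \<Longrightarrow> coeff (vec33 X) S = 0"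
proof -
  assume S: "even (card S)"
  have g: "coeff (gen k) S = 0" for k
    using S by (auto simp: gen_def blade.rep_eq)
  then have E: "coeff (E i) S = 0" "coeff (E' i) S = 0" for i
    by (simp_all add: E_def E'_def scaleR_cl33.rep_eq plus_cl33.rep_eq minus_cl33.rep_eq)
  show ?thesis
    by (simp add: vec33_def sum_3 E plus_cl33.rep_eq scaleR_cl33.rep_eq)
qed

text \<open>Blades multiply by symmetric difference of their index sets, so this is the grading of
  the Clifford algebra modulo 2.\<close>

lemma card_sym_diff_parity:
  fixes S T :: "'a::finite set"
  shows "even (card (sym_diff S T)) \<longleftrightarrow> (even (card S) \<longleftrightarrow> even (card T))"
proof -
  have "card (sym_diff S T) = card (S - T) + card (T - S)"
    by (rule card_Un_disjoint) auto
  moreover have "card S = card (S - T) + card (S \<inter> T)"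
    by (rule card_Int_Diff[simplified add.commute]) simp
  moreover have "card T = card (T - S) + card (S \<inter> T)"
    using card_Int_Diff[of T S] by (simp add: Int_commute)
  ultimately show ?thesis by auto
qed

lemma even_cl_mult:
  assumes "even_cl a" "even_cl b" shows "even_cl (a * b)"
  unfolding even_cl_def times_cl33.rep_eq
proof (intro allI impI sum.neutral ballI)
  fix U S :: "6 set" assume U: "odd (card U)"
  then have "odd (card S) \<or> odd (card (sym_diff S U))"
    by (simp add: card_sym_diff_parity)
  then show "blade_sign S (sym_diff S U) * coeff a S * coeff b (sym_diff S U) = 0"
    using assms unfolding even_cl_def by auto
qed

lemma even_cl_mult_odd:
  assumes "\<And>S. even (card S) \<Longrightarrow> coeff a S = 0" "\<And>S. even (card S) \<Longrightarrow> coeff b S = 0"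
  shows "even_cl (a * b)"
  unfolding even_cl_def times_cl33.rep_eq
proof (intro allI impI sum.neutral ballI)
  fix U S :: "6 set" assume U: "odd (card U)"
  then have "even (card S) \<or> even (card (sym_diff S U))"
    by (simp add: card_sym_diff_parity)
  then show "blade_sign S (sym_diff S U) * coeff a S * coeff b (sym_diff S U) = 0"
    using assms by auto
qed

lemma subspace_even_cl: "subspace {a. even_cl a}"
  by (auto simp: subspace_def even_cl_def zero_cl33.rep_eq plus_cl33.rep_eq scaleR_cl33.rep_eq)

lemma even_cl_bivector:
  assumes "B \<in> bivectors" shows "even_cl B"
proof -
  have "even_cl (outer (vec33 X) (vec33 Y))" for X Y
    unfolding outer_def
    using subspace_scale[OF subspace_even_cl] subspace_diff[OF subspace_even_cl]
      even_cl_mult_odd[OF coeff_vec33_even coeff_vec33_even] by simp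
  then have "bivectors \<subseteq> {a. even_cl a}"
    unfolding bivectors_def by (intro span_minimal subspace_even_cl) auto
  then show ?thesis using assms by blast
qed

text \<open>Allows a coefficient to be taken term by term in the exponential series.\<close>

lemma bounded_linear_coeff: "bounded_linear (\<lambda>a. coeff a S)"
  by (rule bounded_linear_intro[where K = 1])
    (simp_all add: plus_cl33.rep_eq scaleR_cl33.rep_eq abs_coeff_le_norm)

lemma even_cl_exp:
  assumes "even_cl a" shows "even_cl (exp a)"
proof -
  have pow: "even_cl (a ^ n)" for n
  proof (induction n)
    case 0
    show ?case by (simp add: even_cl_def one_cl33.rep_eq)
  next
    case (Suc n)
    then show ?case using even_cl_mult assms by simp
  qed
  have "coeff (exp a) S = (\<Sum>n. coeff (a ^ n /\<^sub>R fact n) S)" for S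
    unfolding exp_def by (rule bounded_linear.suminf[OF bounded_linear_coeff summable_exp_generic])
  then show ?thesis
    using pow by (simp add: even_cl_def scaleR_cl33.rep_eq)
qed

section \<open>Conjugation by the exponential along a linear flow\<close>

lemma exp_bivector_form_action:
  assumes B: "is_bivector_form M B"
    and \<xi>: "\<And>s. (\<xi> has_vector_derivative M *v \<xi> s) (at s)"
    and \<eta>: "\<And>s. (\<eta> has_vector_derivative M *v \<eta> s) (at s)"
  shows "exp B * vec33 (wedge4 (\<xi> 0) (\<eta> 0)) * exp (- B) = vec33 (wedge4 (\<xi> 1) (\<eta> 1))"
proof -
  define Z where "Z s = vec33 (wedge4 (\<xi> s) (\<eta> s))" for s
  define F where "F s = exp (s *\<^sub>R (- B)) * Z s * exp (s *\<^sub>R B)" for s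
  have Z: "(Z has_vector_derivative B * Z s - Z s * B) (at s)" for s
  proof -
    have bw: "bounded_bilinear wedge4"
      using bilinear_wedge4 bilinear_conv_bounded_bilinear by blast
    have bv: "bounded_linear vec33"
      using linear_vec33 linear_conv_bounded_linear by blast
    have "(Z has_vector_derivative
        vec33 (wedge4 (\<xi> s) (M *v \<eta> s) + wedge4 (M *v \<xi> s) (\<eta> s))) (at s)"
      unfolding Z_def
      by (rule bounded_linear.has_vector_derivative[OF bv]
          bounded_bilinear.has_vector_derivative[OF bw] \<xi> \<eta>)+
    \<comment> \<open>The product rule for the wedge is the derivation \<open>ext2 M\<close>, which
      on vectors is the commutator with \<open>B\<close>.\<close>
    moreover have "vec33 (wedge4 (\<xi> s) (M *v \<eta> s) + wedge4 (M *v \<xi> s) (\<eta> s)) = B * Z s - Z s * B"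
      using B unfolding is_bivector_form_def Z_def by (metis ext2_wedge4 add.commute)
    ultimately show ?thesis by simp
  qed
  have "(F has_vector_derivative 0) (at s)" for s
  proof -
    \<comment> \<open>Since \<open>B\<close> commutes with its exponentials, each derivative can be
      written with \<open>B\<close> next to \<open>Z s\<close>; the terms then cancel by
      distributivity.\<close>
    have "(F has_vector_derivative
        (exp (s *\<^sub>R (- B)) * Z s) * (B * exp (s *\<^sub>R B)) +
        (exp (s *\<^sub>R (- B)) * (B * Z s - Z s * B) + (exp (s *\<^sub>R (- B)) * (- B)) * Z s) *
        exp (s *\<^sub>R B)) (at s)"
      unfolding F_def
      by (intro has_vector_derivative_mult Z exp_scaleR_has_vector_derivative_left
          exp_scaleR_has_vector_derivative_right)
    then show ?thesis by (simp add: algebra_simps)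
  qed
  then obtain K where "\<And>s. F s = K"
    using has_vector_derivative_zero_constant[OF convex_UNIV, of F] by auto
  then have "F 1 = F 0" by metis
  then have "exp (- B) * Z 1 * exp B = Z 0" by (simp add: F_def)
  moreover have "exp B * (exp (- B) * Z 1 * exp B) * exp (- B) =
      (exp B * exp (- B)) * Z 1 * (exp B * exp (- B))"
    by (simp only: mult.assoc)
  ultimately show ?thesis
    by (simp add: exp_minus_inverse Z_def)
qed

section \<open>The Lie algebra se(3) in bivector form\<close>

text \<open>Both sides send \<open>(a, b)\<close> to
  \<open>(cross3 u a, cross3 u b + cross3 w a)\<close>: the velocity of the Pluecker coordinates of
  a line with direction \<open>a\<close> and moment \<open>b\<close> under the twist. The factor 1/2
  cancels the 2 in the commutator of an outer product with a vector.\<close>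

lemma twist_bivector_form:
  "is_bivector_form (block4 0 w (matrix (cross3 u)))
    ((1 / 2) *\<^sub>R ((EgtEp u - EltEp u) - EpEp w))" (is "is_bivector_form ?M ?B")
  unfolding is_bivector_form_def
proof (intro conjI allI)
  have o: "outer (E i) (E' j) \<in> bivectors" "outer (E' i) (E' j) \<in> bivectors" for i j
    unfolding bivectors_def vec33_E[symmetric] by (intro span_base; blast)+
  then show "?B \<in> bivectors"
    unfolding EgtEp_def EltEp_def EpEp_def bivectors_def
    by (intro span_scale span_diff span_add) (auto simp: bivectors_def)
  fix X :: r33
  obtain a b where X: "X = (a, b)" by (cases X)
  have "?B * vec33 X - vec33 X * ?B = vec33 (cross3 u a, cross3 u b + cross3 w a)"
  proof -
    have f: "form33 (axis i 1, 0) X = b $ i" "form33 (0, axis i 1) X = a $ i" for i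
      by (simp_all add: X form33_def inner_axis inner_axis')
    have com: "outer (E i) (E' j) * vec33 X - vec33 X * outer (E i) (E' j) =
        (2 * a $ j) *\<^sub>R E i - (2 * b $ i) *\<^sub>R E' j"
      "outer (E' i) (E' j) * vec33 X - vec33 X * outer (E' i) (E' j) =
        (2 * a $ j) *\<^sub>R E' i - (2 * a $ i) *\<^sub>R E' j" for i j
      unfolding vec33_E[symmetric] outer_vec33_commutator f
      by (simp_all only: linear_diff[OF linear_vec33] linear_scale[OF linear_vec33])
    define C where "C p = p * vec33 X - vec33 X * p" for p
    have C: "C (p + q) = C p + C q" "C (p - q) = C p - C q" "C (r *\<^sub>R p) = r *\<^sub>R C p" for p q r
      by (simp_all add: C_def algebra_simps)
    have "C ?B = vec33 (cross3 u a, cross3 u b + cross3 w a)"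
      unfolding EgtEp_def EltEp_def EpEp_def C com[folded C_def] vec33_def sum_3
      by (simp add: cross3_def algebra_simps)
    then show ?thesis by (simp add: C_def)
  qed
  moreover have "ext2 ?M X = (cross3 u a, cross3 u b + cross3 w a)"
    unfolding X prod_eq_iff vec_eq_iff forall_3
    by (simp add: ext2_def Let_def wedge4_def block4_mult cross3_def matrix_works spatial_nth
      matrix_vector_mult_4 e4_nth block4_def space_index_def matrix_def axis_def algebra_simps)
  ultimately show "?B * vec33 X - vec33 X * ?B = vec33 (ext2 ?M X)" by simp
qed

lemma bivector_form_se3:
  "bivector_form (block4 0 w (matrix (cross3 u))) = (1 / 2) *\<^sub>R ((EgtEp u - EltEp u) - EpEp w)"
proof (rule bivector_form_unique[OF is_bivector_form_bivector_form twist_bivector_form])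
  show "block4 0 w (matrix (cross3 u)) \<in> sl4"
    using se3_subset_sl4 by (auto simp: se3_def)
qed

lemma linear_EpEp: "linear EpEp"
  by (rule linearI) (simp_all add: EpEp_def algebra_simps)

lemma linear_EgtEp_EltEp: "linear (\<lambda>y. EgtEp y - EltEp y)"
  by (rule linearI) (simp_all add: EgtEp_def EltEp_def algebra_simps)

text \<open>Both ranges are subspaces, so the span of their union consists of the sums of one
  element from each.\<close>

lemma bivector_form_se3_eq_span:
  "bivector_form ` se3 = span (range EpEp \<union> range (\<lambda>y. EgtEp y - EltEp y))" (is "_ = ?S")
proof -
  note scale = linear_scale[OF linear_EpEp] linear_scale[OF linear_EgtEp_EltEp]
  have "?S = {x + y |x y. x \<in> range EpEp \<and> y \<in> range (\<lambda>y. EgtEp y - EltEp y)}"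
    unfolding span_Un
    by (simp add: span_eq_iff[THEN iffD2] linear_subspace_image linear_EpEp linear_EgtEp_EltEp)
  also have "\<dots> = bivector_form ` se3"
  proof (intro subset_antisym subsetI)
    fix b assume "b \<in> {x + y |x y. x \<in> range EpEp \<and> y \<in> range (\<lambda>y. EgtEp y - EltEp y)}"
    then obtain x y where b: "b = EpEp x + (EgtEp y - EltEp y)" by blast
    \<comment> \<open>The velocities undo the factors -1/2 on the linear part and 1/2 on the angular
      part.\<close>
    have "b = bivector_form (block4 0 ((- 2) *\<^sub>R x) (matrix (cross3 (2 *\<^sub>R y))))"
      unfolding bivector_form_se3 scale b by (simp add: algebra_simps)
    then show "b \<in> bivector_form ` se3" unfolding se3_def by blast
  next
    fix b assume "b \<in> bivector_form ` se3"
    then obtain w u where "b = (1 / 2) *\<^sub>R ((EgtEp u - EltEp u) - EpEp w)"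
      unfolding se3_def using bivector_form_se3 by auto
    also have "\<dots> = EpEp ((- 1 / 2) *\<^sub>R w) + (EgtEp ((1 / 2) *\<^sub>R u) - EltEp ((1 / 2) *\<^sub>R u))"
      unfolding scale by (simp add: algebra_simps)
    finally show "b \<in> {x + y |x y. x \<in> range EpEp \<and> y \<in> range (\<lambda>y. EgtEp y - EltEp y)}"
      by blast
  qed
  finally show ?thesis by simp
qed

section \<open>The screw motion as a flow\<close>

lemma vec4_eqI: "X $ 0 = Y $ 0 \<Longrightarrow> spatial X = spatial Y \<Longrightarrow> X = Y"
proof -
  assume "X $ 0 = Y $ 0" "spatial X = spatial Y"
  \<comment> \<open>\<open>forall_4\<close> ranges over the indices 1, 2, 3, 4; the last one is the
    coordinate 0.\<close>
  moreover have "(4 :: 4) = 0" by simp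
  ultimately show "X = Y"
    unfolding vec_eq_iff forall_4 by (metis spatial_nth)
qed

lemma axis_rotation_has_vector_derivative:
  assumes "norm v = 1"
  shows "((\<lambda>s. axis_rotation v (s * \<theta>) *v u) has_vector_derivative
    \<theta> *\<^sub>R cross3 v (axis_rotation v (s * \<theta>) *v u)) (at s)"
proof -
  have "v \<bullet> v = 1" using assms by (simp add: norm_eq_1)
  \<comment> \<open>This turns the sine term of the rotated vector into the derivative of the two
    cosine terms.\<close>
  have vv: "cross3 v (cross3 v u) = (v \<bullet> u) *\<^sub>R v - (v \<bullet> v) *\<^sub>R u"
    by (simp add: cross3_simps forall_3)
  have "\<theta> *\<^sub>R cross3 v (axis_rotation v (s * \<theta>) *v u) =
      (- sin (s * \<theta>) * \<theta>) *\<^sub>R u + (cos (s * \<theta>) * \<theta>) *\<^sub>R cross3 v u +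
      ((sin (s * \<theta>) * \<theta>) * (v \<bullet> u)) *\<^sub>R v"
    unfolding axis_rotation_apply
    by (simp add: cross_add_right cross_mult_right vv \<open>v \<bullet> v = 1\<close> Cross3.right_diff_distrib
        algebra_simps)
  moreover have "((\<lambda>s. axis_rotation v (s * \<theta>) *v u) has_vector_derivative
      (- sin (s * \<theta>) * \<theta>) *\<^sub>R u + (cos (s * \<theta>) * \<theta>) *\<^sub>R cross3 v u +
      ((sin (s * \<theta>) * \<theta>) * (v \<bullet> u)) *\<^sub>R v) (at s)"
    unfolding axis_rotation_apply by (auto intro!: derivative_eq_intros)
  ultimately show ?thesis by simp
qed

lemma axis_rotation_0: "axis_rotation v 0 *v x = x"
  by (simp add: axis_rotation_apply)

text \<open>A point \<open>x\<close> of the screw motion about the axis through \<open>c\<close> has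
  velocity \<open>d v + \<theta> v \<times> (x - c)\<close>. The part not depending on
  \<open>x\<close> is \<open>\<theta> c \<times> v + d v\<close>, the linear velocity of the twist;
  in homogeneous coordinates it is multiplied by \<open>X $ 0\<close>.\<close>

lemma screw_motion_has_vector_derivative:
  fixes v c :: "real^3" and \<theta> d :: real and X :: "real^4"
  assumes v: "norm v = 1"
  defines "\<xi> \<equiv> \<lambda>s. block4 1 ((s * d) *\<^sub>R v + c - axis_rotation v (s * \<theta>) *v c)
    (axis_rotation v (s * \<theta>)) *v X"
  shows "(\<xi> has_vector_derivative
    block4 0 (\<theta> *\<^sub>R cross3 c v + d *\<^sub>R v) (matrix (cross3 (\<theta> *\<^sub>R v))) *v \<xi> s) (at s)"
    (is "(_ has_vector_derivative ?M *v _) _")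
proof -
  \<comment> \<open>\<open>J\<close> embeds 3-space as the vectors with coordinate 0 equal to zero.
    As that coordinate of \<open>\<xi> s\<close> is constant, only the spatial part has to be
    differentiated.\<close>
  define J :: "real^3 \<Rightarrow> real^4" where "J x = block4 0 x 0 *v e4 0" for x
  have J: "J x $ 0 = 0" "spatial (J x) = x" for x
    by (simp_all add: J_def block4_mult) (simp add: spatial_def e4_def axis_def vec_eq_iff forall_3)
  have "linear J"
    by (rule linearI; rule vec4_eqI)
      (simp_all add: J linear_add[OF linear_spatial] linear_scale[OF linear_spatial])
  then have bJ: "bounded_linear J"
    using linear_conv_bounded_linear by blast
  have split: "Z = Z $ 0 *\<^sub>R e4 0 + J (spatial Z)" for Z
    by (rule vec4_eqI)
      (simp_all add: J linear_add[OF linear_spatial] linear_scale[OF linear_spatial] e4_nth,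
       simp add: spatial_def e4_nth vec_eq_iff forall_3)
  let ?R = "\<lambda>s. axis_rotation v (s * \<theta>)"
  let ?x = "\<lambda>s. X $ 0 *\<^sub>R ((s * d) *\<^sub>R v + c - ?R s *v c) + ?R s *v spatial X"
  have \<xi>: "\<xi> s = X $ 0 *\<^sub>R e4 0 + J (?x s)" for s
    by (subst split) (simp add: \<xi>_def block4_mult)
  have "(?x has_vector_derivative
      X $ 0 *\<^sub>R (d *\<^sub>R v - \<theta> *\<^sub>R cross3 v (?R s *v c)) + \<theta> *\<^sub>R cross3 v (?R s *v spatial X)) (at s)"
    by (auto intro!: derivative_eq_intros axis_rotation_has_vector_derivative[OF v])
  from bounded_linear.has_vector_derivative[OF bJ this]
  have "(\<xi> has_vector_derivative
      J (X $ 0 *\<^sub>R (d *\<^sub>R v - \<theta> *\<^sub>R cross3 v (?R s *v c)) + \<theta> *\<^sub>R cross3 v (?R s *v spatial X))) (at s)"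
    unfolding \<xi> by (auto intro!: derivative_eq_intros)
  moreover have "J (X $ 0 *\<^sub>R (d *\<^sub>R v - \<theta> *\<^sub>R cross3 v (?R s *v c)) +
      \<theta> *\<^sub>R cross3 v (?R s *v spatial X)) = ?M *v \<xi> s"
  proof (rule vec4_eqI)
    have cm: "matrix (cross3 u) *v x = cross3 u x" for u x
      by (rule matrix_works) (use bilinear_cross in \<open>simp add: bilinear_def linear_matrix_vector_mul_eq\<close>)
    show "spatial (J (X $ 0 *\<^sub>R (d *\<^sub>R v - \<theta> *\<^sub>R cross3 v (?R s *v c)) +
      \<theta> *\<^sub>R cross3 v (?R s *v spatial X))) = spatial (?M *v \<xi> s)"
      unfolding J block4_mult cm \<xi>_def
      by (simp add: cross_add_right cross_mult_right cross_mult_left Cross3.right_diff_distrib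
          cross_skew[of c v] algebra_simps)
  qed (simp add: J block4_mult)
  ultimately show ?thesis by simp
qed

section \<open>Null 3-spaces and the centre of the screw\<close>

lemma surj_block4:
  assumes "orthogonal_matrix R" shows "surj ((*v) (block4 1 T R))"
proof (rule linear_inj_imp_surj)
  show "linear ((*v) (block4 1 T R))" by simp
  show "inj ((*v) (block4 1 T R))"
  proof (rule injI, rule vec4_eqI)
    fix X Y assume eq: "block4 1 T R *v X = block4 1 T R *v Y"
    show 0: "X $ 0 = Y $ 0"
      using block4_mult(1)[of 1 T R X] block4_mult(1)[of 1 T R Y] eq by simp
    have "R *v spatial X = R *v spatial Y"
      using block4_mult(2)[of 1 T R X] block4_mult(2)[of 1 T R Y] eq 0 by simp
    then have "(transpose R ** R) *v spatial X = (transpose R ** R) *v spatial Y"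
      by (metis matrix_vector_mul_assoc)
    then show "spatial X = spatial Y"
      using assms by (simp add: orthogonal_matrix)
  qed
qed

text \<open>Conjugation takes the wedge of \<open>X\<close> and \<open>Y\<close> to the wedge of
  their images under the motion matrix. As that matrix is surjective, the image of \<open>Y\<close>
  runs through all of 4-space and the whole null 3-space of the image of \<open>X\<close> is
  reached.\<close>

lemma induces_motionI:
  assumes "even_cl B" "orthogonal_matrix R"
    and conj: "\<And>X Y. exp B * vec33 (wedge4 X Y) * exp (- B) =
      vec33 (wedge4 (block4 1 t R *v X) (block4 1 t R *v Y))"
  shows "induces_motion (exp B) R t"
proof -
  have inv: "exp B * exp (- B) = 1" "exp (- B) * exp B = 1"
    using exp_minus_inverse[of B] exp_minus_inverse[of "- B"] by simp_all
  have "(\<lambda>Z. exp B * Z * inverse_cl (exp B)) ` null_3space X = null_3space (block4 1 t R *v X)" for X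
  proof -
    have null: "null_3space X = vec33 ` wedge4 X ` UNIV" for X
      by (auto simp: null_3space_def)
    have "(\<lambda>Z. exp B * Z * inverse_cl (exp B)) ` null_3space X =
        vec33 ` wedge4 (block4 1 t R *v X) ` range ((*v) (block4 1 t R))"
      unfolding null inverse_cl_unique[OF inv] by (simp add: image_image conj)
    then show ?thesis
      by (simp add: surj_block4[OF assms(2)] null)
  qed
  then show ?thesis
    unfolding induces_motion_def invertible_cl_def
    using even_cl_exp[OF assms(1)] inv by blast
qed

text \<open>On the plane orthogonal to \<open>v\<close>, the map \<open>cross3 v\<close> is
  multiplication by the imaginary unit i. There 1 - exp(i \<theta>) = 2 sin(\<theta>/2) exp(i
  (\<theta> - pi)/2), whose inverse is the scaled rotation by (pi - \<theta>)/2 that defines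
  \<open>c\<close>.\<close>

lemma screw_center:
  assumes v: "norm v = 1" and \<theta>: "sin (\<theta> / 2) \<noteq> 0" and "v \<bullet> u = 0"
  defines "c \<equiv> (1 / (2 * sin (\<theta> / 2))) *\<^sub>R (axis_rotation v ((pi - \<theta>) / 2) *v u)"
  shows "c - axis_rotation v \<theta> *v c = u"
proof -
  let ?h = "\<theta> / 2"
  have vv: "cross3 v (cross3 v u) = - u"
  proof -
    have "cross3 v (cross3 v u) = (v \<bullet> u) *\<^sub>R v - (v \<bullet> v) *\<^sub>R u"
      by (simp add: cross3_simps forall_3)
    then show ?thesis using v assms(3) by (simp add: norm_eq_1)
  qed
  have "cos ((pi - \<theta>) / 2) = sin ?h" "sin ((pi - \<theta>) / 2) = cos ?h"
    by (simp_all add: diff_divide_distrib cos_diff sin_diff)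
  then have c: "c = (1 / (2 * sin ?h)) *\<^sub>R (sin ?h *\<^sub>R u + cos ?h *\<^sub>R cross3 v u)"
    using assms(3) by (simp add: c_def axis_rotation_orthogonal)
  have "v \<bullet> c = 0"
    using assms(3) by (simp add: c inner_add_right dot_cross_self)
  then have "c - axis_rotation v \<theta> *v c = (1 - cos \<theta>) *\<^sub>R c - sin \<theta> *\<^sub>R cross3 v c"
    by (simp add: axis_rotation_orthogonal algebra_simps)
  \<comment> \<open>Half angles expose the factor 2 sin(\<theta>/2), which cancels the denominator
    of \<open>c\<close>; the terms in \<open>cross3 v u\<close> then cancel.\<close>
  also have "\<dots> = (2 * sin ?h ^ 2) *\<^sub>R c - (2 * sin ?h * cos ?h) *\<^sub>R cross3 v c"
    using cos_double_sin[of ?h] sin_double[of ?h] by simp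
  also have "\<dots> = (sin ?h ^ 2 + cos ?h ^ 2) *\<^sub>R u"
    using \<theta> by (simp add: c cross_mult_right cross_add_right vv power2_eq_square algebra_simps
        del: sin_cos_squared_add sin_cos_squared_add2 sin_cos_squared_add3)
  finally show ?thesis by simp
qed

theorem proposition37:
  fixes v t c :: "real^3" and \<theta> d :: real and R :: "real^3^3"
  assumes "norm v = 1"
    and "\<theta> \<notin> range (\<lambda>k::int. 2 * pi * of_int k)"
    and "R = axis_rotation v \<theta>"
    and "d = t \<bullet> v"
    and "c = (1 / (2 * sin (\<theta> / 2))) *\<^sub>R (axis_rotation v ((pi - \<theta>) / 2) *v (t - (t \<bullet> v) *\<^sub>R v))"
  shows "induces_motion
      (exp ((1 / 2) *\<^sub>R
        ((EgtEp (\<theta> *\<^sub>R v) - EltEp (\<theta> *\<^sub>R v)) - EpEp (\<theta> *\<^sub>R cross3 c v + d *\<^sub>R v)))) R t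
    \<and> bivector_form ` se3 = span (range EpEp \<union> range (\<lambda>y. EgtEp y - EltEp y))"
proof
  let ?w = "\<theta> *\<^sub>R cross3 c v + d *\<^sub>R v"
  let ?B = "(1 / 2) *\<^sub>R ((EgtEp (\<theta> *\<^sub>R v) - EltEp (\<theta> *\<^sub>R v)) - EpEp ?w)"
  have form: "is_bivector_form (block4 0 ?w (matrix (cross3 (\<theta> *\<^sub>R v)))) ?B"
    by (rule twist_bivector_form)
  show "induces_motion (exp ?B) R t"
  proof (rule induces_motionI)
    show "even_cl ?B"
      using form even_cl_bivector is_bivector_form_def by blast
    show "orthogonal_matrix R"
      using rotation_matrix_axis_rotation[OF assms(1)] assms(3) by (simp add: rotation_matrix_def)
    fix X Y
    \<comment> \<open>This is where \<theta> not being a multiple of 2 pi enters: the centre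
      \<open>c\<close> divides by this sine.\<close>
    have "sin (\<theta> / 2) \<noteq> 0"
    proof
      assume "sin (\<theta> / 2) = 0"
      then obtain k :: int where "\<theta> / 2 = of_int k * pi"
        by (auto simp: sin_zero_iff_int2)
      then have "\<theta> = 2 * pi * of_int k" by simp
      then show False using assms(2) by blast
    qed
    moreover have "v \<bullet> (t - (t \<bullet> v) *\<^sub>R v) = 0"
      using assms(1) by (simp add: inner_diff_right norm_eq_1 inner_commute)
    ultimately have "c - R *v c = t - (t \<bullet> v) *\<^sub>R v"
      unfolding assms(3,5) by (rule screw_center[OF assms(1)])
    \<comment> \<open>The rotation about \<open>c\<close> supplies the part of \<open>t\<close>
      orthogonal to \<open>v\<close>, the slide along the axis the part parallel to it.\<close>
    then have t: "d *\<^sub>R v + c - R *v c = t"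
      by (simp add: assms(4) algebra_simps)
    \<comment> \<open>The flow line starting at \<open>Z\<close>: the identity at
      \<open>s = 0\<close>, the given motion at \<open>s = 1\<close>.\<close>
    define \<xi> where "\<xi> Z s = block4 1 ((s * d) *\<^sub>R v + c - axis_rotation v (s * \<theta>) *v c)
      (axis_rotation v (s * \<theta>)) *v Z" for Z s
    have der: "(\<xi> Z has_vector_derivative
        block4 0 ?w (matrix (cross3 (\<theta> *\<^sub>R v))) *v \<xi> Z s) (at s)" for Z s
      unfolding \<xi>_def by (rule screw_motion_has_vector_derivative[OF assms(1)])
    have "exp ?B * vec33 (wedge4 (\<xi> X 0) (\<xi> Y 0)) * exp (- ?B) = vec33 (wedge4 (\<xi> X 1) (\<xi> Y 1))"
      by (rule exp_bivector_form_action[OF form der der])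
    moreover have "\<xi> Z 0 = Z" for Z
      by (rule vec4_eqI) (simp_all add: \<xi>_def block4_mult axis_rotation_0)
    moreover have "\<xi> Z 1 = block4 1 t R *v Z" for Z
      using t by (simp add: \<xi>_def assms(3))
    ultimately show "exp ?B * vec33 (wedge4 X Y) * exp (- ?B) =
        vec33 (wedge4 (block4 1 t R *v X) (block4 1 t R *v Y))"
      by simp
  qed
  show "bivector_form ` se3 = span (range EpEp \<union> range (\<lambda>y. EgtEp y - EltEp y))"
    by (rule bivector_form_se3_eq_span)
qed

end
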